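(* Let $\alpha>3$, $\beta>0$, $t_0>0$, let $\Phi:\mathcal H\to\mathbb R$ be a twice continuously differentiable convex function with $\operatorname{argmin}\Phi\neq\emptyset$, and let $x:[t_0,+\infty[\to\mathcal H$ be a solution of $$\ddot x(t)+\frac{\alpha}{t}\dot x(t)+\beta\nabla^2\Phi(x(t))\dot x(t)+\nabla\Phi(x(t))=0 .$$ Then $x(t)$ converges weakly in $\mathcal H$, as $t\to+\infty$, to a point in $\operatorname{argmin}\Phi$.
   Context: $\mathcal H$ is a real Hilbert space. A solution $x$ of the differential equation is a twice continuously differentiable function satisfying it for all $t\ge t_0$. *)

theory Defs
  imports "HOL-Analysis.Analysis"
begin

text \<open>Real Hilbert spaces are types of sort \<open>{real_inner, banach}\<close>.

  Derivatives are Frechet derivatives, bundled as bounded linear maps so that continuity of the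
  second derivative refers to the operator norm. On \<open>S = {t0..}\<close> the derivative at the end point
  is one-sided. The definition determines derivatives uniquely only for sets such as
  \<open>UNIV\<close> and \<open>{t0..}\<close>, the only ones used below.\<close>

definition twice_continuously_differentiable_on ::
    "('a::real_normed_vector \<Rightarrow> 'b::real_normed_vector) \<Rightarrow> 'a set \<Rightarrow> bool" where
  "twice_continuously_differentiable_on f S \<longleftrightarrow>
     (\<exists>(f' :: 'a \<Rightarrow> 'a \<Rightarrow>\<^sub>L 'b) (f'' :: 'a \<Rightarrow> 'a \<Rightarrow>\<^sub>L ('a \<Rightarrow>\<^sub>L 'b)).
        (\<forall>x\<in>S. (f has_derivative blinfun_apply (f' x)) (at x within S)) \<and>
        (\<forall>x\<in>S. (f' has_derivative blinfun_apply (f'' x)) (at x within S)) \<and>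
        continuous_on S f'')"

definition gradient :: "('a::real_inner \<Rightarrow> real) \<Rightarrow> 'a \<Rightarrow> 'a" where
  "gradient f x = (THE D. GDERIV f x :> D)"

definition hessian :: "('a::real_inner \<Rightarrow> real) \<Rightarrow> 'a \<Rightarrow> 'a \<Rightarrow> 'a" where
  "hessian f x = frechet_derivative (gradient f) (at x)"

definition argmin :: "('a \<Rightarrow> real) \<Rightarrow> 'a set" where
  "argmin f = {z. is_arg_min f (\<lambda>_. True) z}"

definition weakly_tendsto ::
    "('b \<Rightarrow> 'a::real_normed_vector) \<Rightarrow> 'a \<Rightarrow> 'b filter \<Rightarrow> bool" where
  "weakly_tendsto x z F \<longleftrightarrow>
     (\<forall>l :: 'a \<Rightarrow> real. bounded_linear l \<longrightarrow> ((\<lambda>t. l (x t)) \<longlongrightarrow> l z) F)"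

text \<open>Trajectories on \<open>[t0, \<infinity>[\<close> are total functions on the reals whose values below \<open>t0\<close> are
  irrelevant: all derivatives are taken within \<open>{t0..}\<close>.\<close>

definition velocity :: "real \<Rightarrow> (real \<Rightarrow> 'a::real_normed_vector) \<Rightarrow> real \<Rightarrow> 'a" where
  "velocity t0 x t = vector_derivative x (at t within {t0..})"

definition acceleration :: "real \<Rightarrow> (real \<Rightarrow> 'a::real_normed_vector) \<Rightarrow> real \<Rightarrow> 'a" where
  "acceleration t0 x t = vector_derivative (velocity t0 x) (at t within {t0..})"

definition din_avd_solution ::
    "real \<Rightarrow> real \<Rightarrow> real \<Rightarrow> ('a::real_inner \<Rightarrow> real) \<Rightarrow> (real \<Rightarrow> 'a) \<Rightarrow> bool" where
  "din_avd_solution \<alpha> \<beta> t0 \<Phi> x \<longleftrightarrow>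
     twice_continuously_differentiable_on x {t0..} \<and>
     (\<forall>t\<ge>t0. acceleration t0 x t + (\<alpha> / t) *\<^sub>R velocity t0 x t
        + \<beta> *\<^sub>R hessian \<Phi> (x t) (velocity t0 x t) + gradient \<Phi> (x t) = 0)"

end

(* For 2 < l < alpha - 1 the energy
     E_l(t) = t (t - beta (l + 2 - alpha)) (Phi(x) - Phi(z)) + l (alpha - l - 1) / 2 |x - z|^2
              + 1/2 |l (x - z) + t (x' + beta grad Phi(x))|^2
   is eventually nonnegative, with E_l' <= -c <x - z, grad Phi(x)> for some c > 0. Hence it converges,
   <x - z, grad Phi(x)> is integrable, and t (Phi(x) - Phi(z)) tends to 0.
   Comparing two values of l then shows that (alpha - 1) q + t q' converges, where
   q(t) = |x - z|^2 / 2 + beta times the integral of <x - z, grad Phi(x)>; so q and |x - z| converge.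
   Opial's argument concludes, since weak cluster points of x minimise Phi by convexity. *)

theory Submission
  imports Defs
begin

subsection \<open>Riesz representation and gradients\<close>

text \<open>The representer is the minimiser of \<open>Q y = |y|^2/2 - l y\<close>. A minimising
  sequence converges by the parallelogram identity and completeness, and stationarity of
  \<open>Q\<close> at the limit is the claimed formula.\<close>

lemma riesz_representation:
  fixes l :: "'a::{real_inner, banach} \<Rightarrow> real"
  assumes "bounded_linear l"
  obtains z where "\<And>h. l h = inner z h"
proof -
  interpret l: bounded_linear l by fact
  define Q where "Q y = (norm y)\<^sup>2 / 2 - l y" for y
  define m where "m = Inf (range Q)"
  obtain K where K: "\<And>y. norm (l y) \<le> norm y * K" using l.bounded by blast
  have "Q y \<ge> - (K\<^sup>2 / 2)" for y
  proof -
    have "l y \<le> norm y * K" using K[of y] by simp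
    moreover have "0 \<le> (norm y - K)\<^sup>2" by simp
    ultimately show ?thesis unfolding Q_def by (simp add: power2_diff)
  qed
  then have bdd: "bdd_below (range Q)" by (meson bdd_belowI2)
  have m_le: "m \<le> Q y" for y unfolding m_def using bdd by (simp add: cInf_lower)
  have "\<exists>y. Q y < m + 1 / (real n + 1)" for n
    using cInf_lessD[of "range Q" "m + 1 / (real n + 1)"] by (force simp: m_def)
  then obtain y where y: "\<And>n. Q (y n) < m + 1 / (real n + 1)" by metis
  \<comment> \<open>\<open>Q\<close> at the midpoint is the mean of \<open>Q u\<close> and
    \<open>Q v\<close> minus \<open>|u - v|^2/8\<close>, and it is at least \<open>m\<close>; so
    near-minimisers are close to each other.\<close>
  have par: "(norm (u - v))\<^sup>2 \<le> 4 * (Q u + Q v - 2 * m)" for u v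
  proof -
    have "Q ((1/2) *\<^sub>R (u + v)) = (Q u + Q v) / 2 - (norm (u - v))\<^sup>2 / 8"
      unfolding Q_def power2_norm_eq_inner
      by (simp add: l.scaleR l.add inner_add inner_diff inner_commute field_simps)
    with m_le[of "(1/2) *\<^sub>R (u + v)"] show ?thesis by argo
  qed
  have "Cauchy y"
  proof (rule metric_CauchyI)
    fix e :: real assume "0 < e"
    then obtain N where N: "1 / (real N + 1) < e\<^sup>2 / 8"
      using reals_Archimedean[of "e\<^sup>2 / 8"] by (auto simp: inverse_eq_divide add.commute)
    have "dist (y i) (y j) < e" if "i \<ge> N" "j \<ge> N" for i j
    proof -
      have "Q (y n) - m < e\<^sup>2 / 8" if "n \<ge> N" for n
      proof -
        have "1 / (real n + 1) \<le> 1 / (real N + 1)" using that by (intro divide_left_mono) auto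
        with y[of n] N show ?thesis by linarith
      qed
      from this[OF \<open>i \<ge> N\<close>] this[OF \<open>j \<ge> N\<close>] par[of "y i" "y j"]
      have "(norm (y i - y j))\<^sup>2 < e\<^sup>2" by argo
      then show ?thesis using \<open>0 < e\<close> by (simp add: dist_norm power2_less_imp_less)
    qed
    then show "\<exists>N. \<forall>i\<ge>N. \<forall>j\<ge>N. dist (y i) (y j) < e" by blast
  qed
  then obtain z where z: "y \<longlonglongrightarrow> z" using Cauchy_convergent convergent_def by blast
  have "(\<lambda>n. Q (y n)) \<longlonglongrightarrow> Q z"
    unfolding Q_def by (intro tendsto_intros l.tendsto z) simp
  moreover have "(\<lambda>n. m + 1 / (real n + 1)) \<longlonglongrightarrow> m + 0"
    by (intro tendsto_intros) (use LIMSEQ_Suc[OF lim_1_over_n[where 'a=real]] in \<open>simp add: add.commute\<close>)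
  ultimately have "Q z \<le> m + 0"
    by (rule LIMSEQ_le) (use y less_imp_le in blast)
  then have "Q z \<le> m" by simp
  have "l h = inner z h" for h
  proof (cases "h = 0")
    case False
    define d where "d = inner z h - l h"
    \<comment> \<open>This \<open>s\<close> minimises the quadratic
      \<open>s * d + s^2 |h|^2 / 2\<close>, the change of \<open>Q\<close> in direction
      \<open>h\<close>; its minimum is negative unless \<open>d = 0\<close>.\<close>
    define s where "s = - d / (norm h)\<^sup>2"
    have "0 \<le> Q (z + s *\<^sub>R h) - Q z" using \<open>Q z \<le> m\<close> m_le[of "z + s *\<^sub>R h"] by linarith
    also have "\<dots> = s * d + s\<^sup>2 * (norm h)\<^sup>2 / 2"
      unfolding Q_def d_def power2_norm_eq_inner
      by (simp add: l.scaleR l.add inner_add inner_commute field_simps power2_eq_square)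
    also have "\<dots> = - d\<^sup>2 / (2 * (norm h)\<^sup>2)"
      unfolding s_def using False by (simp add: field_simps power2_eq_square)
    finally have "d\<^sup>2 / (2 * (norm h)\<^sup>2) \<le> 0" by simp
    then have "d = 0" using False by (simp add: divide_le_0_iff)
    then show ?thesis by (simp add: d_def)
  qed (simp add: l.zero)
  then show thesis using that by blast
qed

definition riesz :: "('a::{real_inner, banach} \<Rightarrow>\<^sub>L real) \<Rightarrow> 'a" where
  "riesz l = (SOME z. \<forall>h. blinfun_apply l h = inner z h)"

lemma inner_riesz: "inner (riesz l) h = blinfun_apply l h"
  unfolding riesz_def
  by (rule someI2_ex) (metis riesz_representation blinfun.bounded_linear_right, simp)

lemma riesz_eqI: "(\<And>h. blinfun_apply l h = inner z h) \<Longrightarrow> riesz l = z"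
  by (metis inner_riesz vector_eq_rdot)

text \<open>Transports differentiability of a functional-valued derivative to the gradient. The norm
  bound comes from testing \<open>l\<close> on its own representer.\<close>

lemma bounded_linear_riesz: "bounded_linear riesz"
proof (rule bounded_linear_intro[where K = 1])
  fix k l :: "'a \<Rightarrow>\<^sub>L real" and r
  show "riesz (k + l) = riesz k + riesz l"
    by (rule riesz_eqI) (simp add: inner_add inner_riesz blinfun.add_left)
  show "riesz (r *\<^sub>R l) = r *\<^sub>R riesz l"
    by (rule riesz_eqI) (simp add: inner_riesz blinfun.scaleR_left)
  have "norm (riesz l) * norm (riesz l) \<le> norm l * norm (riesz l)"
    using norm_blinfun[of l "riesz l"]
    by (simp add: inner_riesz[symmetric] norm_eq_sqrt_inner)
  then show "norm (riesz l) \<le> norm l * 1" by (cases "riesz l = 0") auto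
qed

lemma blinfun_apply_eq_inner_riesz: "blinfun_apply l = (\<lambda>h. inner h (riesz l))"
  by (simp add: fun_eq_iff inner_commute[of _ "riesz l"] inner_riesz)

lemma gradient_eqI:
  assumes "(f has_derivative blinfun_apply D) (at x)"
  shows "gradient f x = riesz D"
  unfolding gradient_def gderiv_def
proof (rule the_equality)
  show "(f has_derivative (\<lambda>h. inner h (riesz D))) (at x)"
    using assms by (simp only: blinfun_apply_eq_inner_riesz)
  fix E assume "(f has_derivative (\<lambda>h. inner h E)) (at x)"
  then have "(\<lambda>h. inner h E) = blinfun_apply D" by (rule has_derivative_unique[OF _ assms])
  then show "E = riesz D" by (metis riesz_eqI inner_commute)
qed

text \<open>Turns the description operators behind \<open>gradient\<close> and
  \<open>hessian\<close> into genuine derivatives: the gradient is \<open>riesz\<close> after the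
  bundled derivative, so the bounded linear chain rule applies.\<close>

lemma gradient_hessian:
  fixes \<Phi> :: "'a::{real_inner, banach} \<Rightarrow> real"
  assumes "twice_continuously_differentiable_on \<Phi> UNIV"
  shows GDERIV_gradient: "GDERIV \<Phi> y :> gradient \<Phi> y"
    and gradient_has_derivative_hessian: "(gradient \<Phi> has_derivative hessian \<Phi> y) (at y)"
proof -
  obtain f' f'' where f': "\<And>x. (\<Phi> has_derivative blinfun_apply (f' x)) (at x)"
    and f'': "\<And>x. (f' has_derivative blinfun_apply (f'' x)) (at x)"
    using assms unfolding twice_continuously_differentiable_on_def by auto
  have g: "gradient \<Phi> = (\<lambda>x. riesz (f' x))" using gradient_eqI[OF f'] by blast
  show "GDERIV \<Phi> y :> gradient \<Phi> y"
    unfolding gderiv_def g using f'[of y] by (simp only: blinfun_apply_eq_inner_riesz)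
  have "(gradient \<Phi> has_derivative (\<lambda>h. riesz (f'' y h))) (at y)"
    unfolding g by (rule bounded_linear.has_derivative[OF bounded_linear_riesz f''])
  then show "(gradient \<Phi> has_derivative hessian \<Phi> y) (at y)"
    unfolding hessian_def using frechet_derivative_at by force
qed

text \<open>Restricting \<open>f\<close> to the line through \<open>y\<close> and \<open>z\<close>
  reduces this to the tangent inequality for convex functions of one real variable.\<close>

lemma convex_on_gradient_le:
  fixes f :: "'a::real_inner \<Rightarrow> real"
  assumes "convex_on UNIV f" and D: "GDERIV f y :> D"
  shows "f y + inner D (z - y) \<le> f z"
proof -
  define u where "u s = f (y + s *\<^sub>R (z - y))" for s :: real
  have "convex_on UNIV u"
  proof (rule convex_onI)
    fix t a b :: real assume t: "0 < t" "t < 1"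
    have "y + ((1 - t) *\<^sub>R a + t *\<^sub>R b) *\<^sub>R (z - y)
        = (1 - t) *\<^sub>R (y + a *\<^sub>R (z - y)) + t *\<^sub>R (y + b *\<^sub>R (z - y))"
      by (simp add: algebra_simps)
    then show "u ((1 - t) *\<^sub>R a + t *\<^sub>R b) \<le> (1 - t) * u a + t * u b"
      unfolding u_def using convex_onD[OF assms(1), of t] t by simp
  qed simp
  moreover have "(u has_real_derivative inner D (z - y)) (at 0 within UNIV)"
  proof -
    have "((\<lambda>s::real. y + s *\<^sub>R (z - y)) has_derivative (\<lambda>s. s *\<^sub>R (z - y))) (at 0)"
      by (auto intro!: derivative_eq_intros)
    moreover have "(f has_derivative (\<lambda>h. inner h D)) (at (y + 0 *\<^sub>R (z - y)))"
      using D by (simp add: gderiv_def)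
    ultimately have "((\<lambda>s. f (y + s *\<^sub>R (z - y))) has_derivative (\<lambda>s. inner (s *\<^sub>R (z - y)) D)) (at 0)"
      by (rule has_derivative_compose)
    then have "(u has_derivative (\<lambda>s. inner (s *\<^sub>R (z - y)) D)) (at 0)"
      by (simp add: u_def[abs_def])
    then show ?thesis
      by (simp add: has_field_derivative_def inner_commute mult_commute_abs)
  qed
  ultimately have "u 1 - u 0 \<ge> inner D (z - y) * (1 - 0)"
    by (intro convex_on_imp_above_tangent[where A = UNIV]) auto
  then show ?thesis by (simp add: u_def)
qed

subsection \<open>Weak cluster points\<close>

text \<open>Passing to finer filters instead of subsequences reduces weak compactness to Tychonoff's theorem
  for the functions \<open>y \<mapsto> inner (x t) y\<close>, so no separability argument is needed.\<close>

lemma bounded_weak_cluster_point: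
  fixes x :: "'b \<Rightarrow> 'a::{real_inner, banach}"
  assumes F: "F \<noteq> bot" and bd: "\<forall>\<^sub>F t in F. norm (x t) \<le> M"
  obtains G c where "G \<noteq> bot" "G \<le> F" "\<And>y. ((\<lambda>t. inner (x t) y) \<longlongrightarrow> inner c y) G"
proof -
  define X where "X = (\<lambda>t y. inner (x t) y)"
  define K where "K = PiE UNIV (\<lambda>y::'a. cball (0::real) (M * norm y))"
  have "compactin (product_topology (\<lambda>_. euclidean) UNIV) K"
    unfolding K_def compactin_PiE by simp
  then have "compact K" by (simp add: euclidean_product_topology)
  moreover have "filtermap X F \<noteq> bot" using F by (simp add: filtermap_bot_iff)
  moreover have "eventually (\<lambda>f. f \<in> K) (filtermap X F)"
    unfolding eventually_filtermap using bd
  proof eventually_elim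
    case (elim t)
    have "\<bar>inner (x t) y\<bar> \<le> M * norm y" for y
      using Cauchy_Schwarz_ineq2[of "x t" y] elim
      by (meson mult_right_mono norm_ge_zero order_trans)
    then show ?case by (auto simp: K_def X_def)
  qed
  ultimately obtain f where "f \<in> K" and f: "inf (nhds f) (filtermap X F) \<noteq> bot"
    unfolding compact_filter by blast
  \<comment> \<open>Pulling the neighbourhoods of the cluster point \<open>f\<close> back along
    \<open>X\<close> and meeting them with \<open>F\<close> forces \<open>X\<close> to converge to
    \<open>f\<close>. Were this filter trivial, \<open>f\<close> would not be a cluster
    point.\<close>
  define G where "G = inf (filtercomap X (nhds f)) F"
  have "G \<noteq> bot"
  proof
    assume "G = bot"
    then obtain Q R where Q: "eventually Q (filtercomap X (nhds f))" and R: "eventually R F"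
      and QR: "\<And>t. Q t \<Longrightarrow> R t \<Longrightarrow> False"
      unfolding G_def trivial_limit_def eventually_inf by blast
    obtain P where P: "eventually P (nhds f)" "\<And>t. P (X t) \<Longrightarrow> Q t"
      using Q unfolding eventually_filtercomap by blast
    have "eventually (\<lambda>g. \<not> P g) (filtermap X F)"
      unfolding eventually_filtermap using R by eventually_elim (use P QR in blast)
    with P(1) have "eventually (\<lambda>_. False) (inf (nhds f) (filtermap X F))"
      unfolding eventually_inf by blast
    with f show False by (simp add: trivial_limit_def)
  qed
  have "filterlim X (nhds f) G"
    unfolding G_def by (rule filterlim_mono[OF filterlim_filtercomap order_refl inf_le1])
  then have lim: "((\<lambda>t. inner (x t) y) \<longlongrightarrow> f y) G" for y
    using continuous_on_tendsto_compose[OF continuous_on_product_coordinates \<open>filterlim X (nhds f) G\<close>]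
    by (simp add: X_def)
  \<comment> \<open>Linearity passes to the pointwise limit by uniqueness of limits; boundedness is
    membership in \<open>K\<close>. Riesz then gives the weak limit.\<close>
  have "bounded_linear f"
  proof (rule bounded_linear_intro[where K = M])
    fix a b r
    show "f (a + b) = f a + f b"
      using tendsto_unique[OF \<open>G \<noteq> bot\<close> lim tendsto_add[OF lim[of a] lim[of b], folded inner_add_right]] .
    show "f (r *\<^sub>R a) = r *\<^sub>R f a"
      using tendsto_unique[OF \<open>G \<noteq> bot\<close> lim tendsto_mult_left[OF lim[of a], of r, folded inner_scaleR_right]]
      by simp
    show "norm (f a) \<le> norm a * M"
      using \<open>f \<in> K\<close> by (auto simp: K_def mult.commute PiE_iff)
  qed
  then obtain c where "\<And>h. f h = inner c h" by (rule riesz_representation) blast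
  then show thesis using that[of G c] \<open>G \<noteq> bot\<close> lim by (simp add: G_def)
qed

text \<open>Convergence of the distances to points of \<open>S\<close> leaves room for only one weak
  cluster point. If weak convergence to it failed, a cluster point taken along the offending times
  would contradict this uniqueness.\<close>

lemma opial_weakly_tendsto:
  fixes x :: "'b \<Rightarrow> 'a::{real_inner, banach}"
  assumes F: "F \<noteq> bot" and bd: "\<forall>\<^sub>F t in F. norm (x t) \<le> M"
    and dist: "\<And>z. z \<in> S \<Longrightarrow> \<exists>L. ((\<lambda>t. (norm (x t - z))\<^sup>2) \<longlongrightarrow> L) F"
    and cluster: "\<And>G c. G \<noteq> bot \<Longrightarrow> G \<le> F \<Longrightarrow>
      (\<And>y. ((\<lambda>t. inner (x t) y) \<longlongrightarrow> inner c y) G) \<Longrightarrow> c \<in> S"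
  shows "\<exists>z\<in>S. weakly_tendsto x z F"
proof -
  obtain G c where G: "G \<noteq> bot" "G \<le> F"
    and c: "\<And>y. ((\<lambda>t. inner (x t) y) \<longlongrightarrow> inner c y) G"
    using bounded_weak_cluster_point[OF F bd] by metis
  have cS: "c \<in> S" using cluster G c .
  have unique: "c' = c" if G': "G' \<noteq> bot" "G' \<le> F"
    and c': "\<And>y. ((\<lambda>t. inner (x t) y) \<longlongrightarrow> inner c' y) G'" for G' c'
  proof -
    have c'S: "c' \<in> S" using cluster G' c' .
    obtain L1 L2 where L: "((\<lambda>t. (norm (x t - c))\<^sup>2) \<longlongrightarrow> L1) F"
      "((\<lambda>t. (norm (x t - c'))\<^sup>2) \<longlongrightarrow> L2) F"
      using dist[OF cS] dist[OF c'S] by blast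
    define L where "L = (L2 - L1 + (norm c)\<^sup>2 - (norm c')\<^sup>2) / 2"
    \<comment> \<open>The quadratic terms in \<open>x t\<close> cancel, so convergence of both
      distances makes this inner product converge along all of \<open>F\<close>, with the same limit
      along \<open>G\<close> and \<open>G'\<close>.\<close>
    have "inner (x t) (c - c')
        = ((norm (x t - c'))\<^sup>2 - (norm (x t - c))\<^sup>2 + (norm c)\<^sup>2 - (norm c')\<^sup>2) / 2" for t
      by (simp add: power2_norm_eq_inner inner_diff inner_commute)
    then have "((\<lambda>t. inner (x t) (c - c')) \<longlongrightarrow> L) F"
      unfolding L_def by (simp only:) (intro tendsto_intros L, simp)
    then have "((\<lambda>t. inner (x t) (c - c')) \<longlongrightarrow> L) G"
      "((\<lambda>t. inner (x t) (c - c')) \<longlongrightarrow> L) G'"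
      using G(2) G'(2) tendsto_mono by blast+
    then have "inner c (c - c') = L" "inner c' (c - c') = L"
      using tendsto_unique[OF G(1) c] tendsto_unique[OF G'(1) c'] by blast+
    then have "inner (c - c') (c - c') = 0" by (simp add: inner_diff_left)
    then show ?thesis by simp
  qed
  have "((\<lambda>t. l (x t)) \<longlongrightarrow> l c) F" if "bounded_linear l" for l :: "'a \<Rightarrow> real"
  proof (rule ccontr)
    assume "\<not> ((\<lambda>t. l (x t)) \<longlongrightarrow> l c) F"
    then obtain U where U: "open U" "l c \<in> U" "\<not> (\<forall>\<^sub>F t in F. l (x t) \<in> U)"
      unfolding tendsto_def by blast
    \<comment> \<open>Restriction to the times at which \<open>l (x t)\<close> lies outside
      \<open>U\<close>; it is nontrivial because these times occur frequently.\<close>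
    define H where "H = inf F (principal {t. l (x t) \<notin> U})"
    have "H \<noteq> bot" using U(3) by (simp add: H_def trivial_limit_def eventually_inf_principal)
    moreover have "\<forall>\<^sub>F t in H. norm (x t) \<le> M"
      using bd unfolding H_def eventually_inf_principal by eventually_elim simp
    ultimately obtain G' c' where G': "G' \<noteq> bot" "G' \<le> H"
      and c': "\<And>y. ((\<lambda>t. inner (x t) y) \<longlongrightarrow> inner c' y) G'"
      using bounded_weak_cluster_point by metis
    have "c' = c" using unique[OF G'(1) _ c'] G'(2) by (simp add: H_def)
    obtain w where w: "\<And>h. l h = inner w h" using riesz_representation \<open>bounded_linear l\<close> by blast
    have "((\<lambda>t. l (x t)) \<longlongrightarrow> l c) G'"
      using c'[of w] by (simp add: w \<open>c' = c\<close> inner_commute)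
    then have "\<forall>\<^sub>F t in G'. l (x t) \<in> U" using U by (simp add: tendsto_def)
    moreover have "\<forall>\<^sub>F t in G'. l (x t) \<notin> U"
      using filter_leD[OF G'(2), of "\<lambda>t. l (x t) \<notin> U"] by (simp add: H_def eventually_inf_principal)
    ultimately have "\<forall>\<^sub>F t in G'. False" by eventually_elim simp
    with G'(1) show False by (simp add: trivial_limit_def)
  qed
  then show ?thesis using cS unfolding weakly_tendsto_def by blast
qed

subsection \<open>Energy estimates\<close>

text \<open>L'Hospital's rule for \<open>t^m q / t^m\<close>: the quotient of the derivatives is
  \<open>(m q + t q') / m\<close>. Only the denominator has to tend to infinity, so no prior bound
  on \<open>q\<close> is required.\<close>

lemma tendsto_at_top_of_weighted:
  fixes q q' :: "real \<Rightarrow> real"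
  assumes "m > 0" and q: "\<forall>\<^sub>F t in at_top. (q has_real_derivative q' t) (at t)"
    and lim: "((\<lambda>t. m * q t + t * q' t) \<longlongrightarrow> L) at_top"
  shows "(q \<longlongrightarrow> L / m) at_top"
proof -
  have "((\<lambda>t. (t powr m * q t) / t powr m) \<longlongrightarrow> L / m) at_top"
  proof (rule lhospital_at_top_at_top)
    have "LIM t at_top. exp (m * ln t) :> at_top"
      by (intro filterlim_compose[OF exp_at_top]
          filterlim_tendsto_pos_mult_at_top[OF tendsto_const \<open>m > 0\<close>] ln_at_top)
    then show "LIM t at_top. t powr m :> at_top"
      by (rule filterlim_at_top_mono)
        (use eventually_gt_at_top[of 0] in eventually_elim, simp add: powr_def)
    show "\<forall>\<^sub>F t in at_top. m * t powr (m - 1) \<noteq> 0"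
      using eventually_gt_at_top[of 0] by eventually_elim (use \<open>m > 0\<close> in simp)
    show "\<forall>\<^sub>F t in at_top. ((\<lambda>t. t powr m) has_real_derivative m * t powr (m - 1)) (at t)"
      using eventually_gt_at_top[of 0] by eventually_elim (rule has_real_derivative_powr)
    show "\<forall>\<^sub>F t in at_top. ((\<lambda>t. t powr m * q t) has_real_derivative
        m * t powr (m - 1) * q t + t powr m * q' t) (at t)"
      using q eventually_gt_at_top[of 0]
      by eventually_elim (auto intro!: derivative_eq_intros has_real_derivative_powr)
    have "((\<lambda>t. (m * q t + t * q' t) / m) \<longlongrightarrow> L / m) at_top"
      using lim \<open>m > 0\<close> by (intro tendsto_intros) auto
    moreover have "\<forall>\<^sub>F t in at_top. (m * q t + t * q' t) / m
        = (m * t powr (m - 1) * q t + t powr m * q' t) / (m * t powr (m - 1))"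
      using eventually_gt_at_top[of 0]
    proof eventually_elim
      case (elim t)
      have "t powr m = t * t powr (m - 1)" using elim by (simp add: powr_diff)
      then show ?case using elim \<open>m > 0\<close> by (simp add: field_simps)
    qed
    ultimately show "((\<lambda>t. (m * t powr (m - 1) * q t + t powr m * q' t) / (m * t powr (m - 1)))
        \<longlongrightarrow> L / m) at_top"
      by (rule Lim_transform_eventually)
  qed
  moreover have "\<forall>\<^sub>F t in at_top. (t powr m * q t) / t powr m = q t"
    using eventually_gt_at_top[of 0] by eventually_elim simp
  ultimately show ?thesis by (rule Lim_transform_eventually)
qed

lemma antimono_at_top_convergent:
  fixes f f' :: "real \<Rightarrow> real"
  assumes D: "\<And>t. t \<ge> T \<Longrightarrow> (f has_real_derivative f' t) (at t)"
    and le: "\<And>t. t \<ge> T \<Longrightarrow> f' t \<le> 0" and lb: "\<And>t. t \<ge> T \<Longrightarrow> b \<le> f t"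
  shows "\<exists>L. (f \<longlongrightarrow> L) at_top"
proof -
  have anti: "f t \<le> f s" if "T \<le> s" "s \<le> t" for s t
    using that by (intro DERIV_nonpos_imp_nonincreasing[OF \<open>s \<le> t\<close>]) (meson D le order_trans)
  define L where "L = Inf (f ` {T..})"
  have bdd: "bdd_below (f ` {T..})" using lb by (meson atLeast_iff bdd_belowI2)
  have "(f \<longlongrightarrow> L) at_top"
  proof (rule order_tendstoI)
    fix a assume "a < L"
    show "\<forall>\<^sub>F t in at_top. a < f t"
      using eventually_ge_at_top[of T]
      by eventually_elim (metis \<open>a < L\<close> L_def bdd atLeast_iff cInf_lower imageI less_le_trans)
  next
    fix a assume "L < a"
    then obtain s where s: "s \<ge> T" "f s < a"
      using cInf_lessD[of "f ` {T..}" a] by (auto simp: L_def)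
    show "\<forall>\<^sub>F t in at_top. f t < a"
      using eventually_ge_at_top[of s] by eventually_elim (meson anti s le_less_trans)
  qed
  then show ?thesis ..
qed

lemma has_real_derivative_norm_square:
  fixes p :: "real \<Rightarrow> 'a::real_inner"
  assumes "(p has_vector_derivative p') (at t)"
  shows "((\<lambda>t. (norm (p t))\<^sup>2) has_real_derivative 2 * inner (p t) p') (at t)"
  using has_derivative_inner[OF assms[unfolded has_vector_derivative_def]
      assms[unfolded has_vector_derivative_def]]
  by (simp add: power2_norm_eq_inner has_field_derivative_def inner_commute mult_commute_abs algebra_simps)

text \<open>In the locale, \<open>u_deriv\<close> is the differential equation: the chain rule absorbs its Hessian term
  into the derivative of \<open>v + \<beta> g(x)\<close>.\<close>

locale din_avd =
  fixes \<Phi> :: "'a::real_inner \<Rightarrow> real" and g :: "'a \<Rightarrow> 'a" and x v :: "real \<Rightarrow> 'a"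
    and \<alpha> \<beta> t0 :: real and z :: 'a
  assumes \<alpha>: "\<alpha> > 3" and \<beta>: "\<beta> > 0" and t0: "t0 > 0"
    and convex: "convex_on UNIV \<Phi>"
    and gderiv: "\<And>y. GDERIV \<Phi> y :> g y"
    and cont_g: "continuous_on UNIV g"
    and minimum: "\<And>y. \<Phi> z \<le> \<Phi> y"
    and x_deriv: "\<And>t. t > t0 \<Longrightarrow> (x has_vector_derivative v t) (at t)"
    and u_deriv: "\<And>t. t > t0 \<Longrightarrow> ((\<lambda>t. v t + \<beta> *\<^sub>R g (x t)) has_vector_derivative
      - ((\<alpha> / t) *\<^sub>R v t) - g (x t)) (at t)"
begin

section \<open>Lyapunov functions and their derivatives\<close>

definition gap :: "real \<Rightarrow> real" where
  "gap t = \<Phi> (x t) - \<Phi> z"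

definition pairing :: "real \<Rightarrow> real" where
  "pairing t = inner (x t - z) (g (x t))"

definition shift :: "real \<Rightarrow> real \<Rightarrow> 'a" where
  "shift l t = l *\<^sub>R (x t - z) + t *\<^sub>R (v t + \<beta> *\<^sub>R g (x t))"

text \<open>The coefficients of the first two terms are chosen so that the products of
  \<open>v\<close> with \<open>g (x t)\<close> and with \<open>x t - z\<close> cancel in the
  derivative; \<open>energy_rate\<close> is what remains.\<close>

definition energy :: "real \<Rightarrow> real \<Rightarrow> real" where
  "energy l t = t * (t - \<beta> * (l + 2 - \<alpha>)) * gap t
     + l * (\<alpha> - l - 1) / 2 * (norm (x t - z))\<^sup>2 + (norm (shift l t))\<^sup>2 / 2"

definition energy_rate :: "real \<Rightarrow> real \<Rightarrow> real" where
  "energy_rate l t = (2 * t - \<beta> * (l + 2 - \<alpha>)) * gap t - l * (t - \<beta>) * pairing t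
     - t * (\<alpha> - 1 - l) * (norm (v t))\<^sup>2 - t * \<beta> * (t - \<beta>) * (norm (g (x t)))\<^sup>2"

text \<open>Starting at \<open>t0 + 1\<close> keeps the interval inside the open half-line where
  \<open>x\<close> is known to be differentiable, hence continuous.\<close>

definition pairing_integral :: "real \<Rightarrow> real" where
  "pairing_integral t = integral {t0 + 1..t} pairing"

lemma gap_nonneg: "0 \<le> gap t"
  unfolding gap_def using minimum by simp

text \<open>The tangent inequality at \<open>x t\<close>, evaluated at \<open>z\<close>. This is
  where convexity enters the energy estimates.\<close>

lemma gap_le_pairing: "gap t \<le> pairing t"
  using convex_on_gradient_le[OF convex gderiv[of "x t"], of z]
  by (simp add: gap_def pairing_def inner_diff inner_commute)

lemma gap_deriv:
  assumes "t > t0"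
  shows "(gap has_real_derivative inner (g (x t)) (v t)) (at t)"
proof -
  have "(\<Phi> has_derivative (\<lambda>h. inner h (g (x t)))) (at (x t))"
    using gderiv by (simp add: gderiv_def)
  from has_derivative_compose[OF x_deriv[OF assms, unfolded has_vector_derivative_def] this]
  have "((\<lambda>t. \<Phi> (x t)) has_real_derivative inner (g (x t)) (v t)) (at t)"
    by (simp add: has_field_derivative_def inner_commute mult_commute_abs)
  from DERIV_diff[OF this DERIV_const[of "\<Phi> z"]] show ?thesis
    by (simp add: gap_def[abs_def])
qed

lemma x_diff_deriv: "t > t0 \<Longrightarrow> ((\<lambda>t. x t - z) has_vector_derivative v t) (at t)"
  using has_vector_derivative_diff[OF x_deriv has_vector_derivative_const] by simp

text \<open>The factor \<open>t\<close> turns the damping \<open>(alpha / t) v\<close> into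
  \<open>alpha v\<close>, and \<open>u_deriv\<close> keeps the Hessian out of the formula.\<close>

lemma shift_deriv:
  assumes "t > t0"
  shows "(shift l has_vector_derivative (l + 1 - \<alpha>) *\<^sub>R v t + (\<beta> - t) *\<^sub>R g (x t)) (at t)"
proof -
  have "t \<noteq> 0" using assms t0 by simp
  have "(shift l has_vector_derivative l *\<^sub>R v t +
     (t *\<^sub>R (- ((\<alpha> / t) *\<^sub>R v t) - g (x t)) + 1 *\<^sub>R (v t + \<beta> *\<^sub>R g (x t)))) (at t)"
    unfolding shift_def
    by (rule has_vector_derivative_add[OF
          bounded_linear.has_vector_derivative[OF bounded_linear_scaleR_right x_diff_deriv[OF assms]]
          has_vector_derivative_scaleR[OF DERIV_ident u_deriv[OF assms]]])
  moreover have "l *\<^sub>R v t + (t *\<^sub>R (- ((\<alpha> / t) *\<^sub>R v t) - g (x t)) + 1 *\<^sub>R (v t + \<beta> *\<^sub>R g (x t)))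
     = (l + 1 - \<alpha>) *\<^sub>R v t + (\<beta> - t) *\<^sub>R g (x t)"
    using \<open>t \<noteq> 0\<close> by (simp add: algebra_simps)
  ultimately show ?thesis by simp
qed

lemma energy_deriv:
  assumes "t > t0"
  shows "(energy l has_real_derivative energy_rate l t) (at t)"
proof -
  define c where "c = \<beta> * (l + 2 - \<alpha>)"
  define D where "D = (2 * t - c) * gap t + inner (g (x t)) (v t) * (t * (t - c))
      + l * (\<alpha> - l - 1) / 2 * (2 * inner (x t - z) (v t))
      + (2 * inner (shift l t) ((l + 1 - \<alpha>) *\<^sub>R v t + (\<beta> - t) *\<^sub>R g (x t))) / 2"
  have "((\<lambda>t. t * (t - c)) has_real_derivative 2 * t - c) (at t)"
    by (auto intro!: derivative_eq_intros)
  then have "(energy l has_real_derivative D) (at t)"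
    unfolding energy_def c_def[symmetric] D_def
    by (rule DERIV_add[OF DERIV_add[OF DERIV_mult[OF _ gap_deriv[OF assms]]
          DERIV_cmult[OF has_real_derivative_norm_square[OF x_diff_deriv[OF assms]]]]
          DERIV_cdivide[OF has_real_derivative_norm_square[OF shift_deriv[OF assms]]]])
  \<comment> \<open>The inner product with \<open>shift\<close> contributes
    \<open>-t (t - c)\<close> to the coefficient of \<open><g, v>\<close> and
    \<open>-l (alpha - l - 1)\<close> to that of \<open><x - z, v>\<close>, cancelling the first two
    terms.\<close>
  moreover have "D = energy_rate l t"
  proof -
    define y where "y = x t - z"
    show ?thesis
      unfolding D_def c_def energy_rate_def shift_def pairing_def power2_norm_eq_inner y_def[symmetric]
        inner_add_left inner_add_right inner_scaleR_left inner_scaleR_right inner_commute[of "v t" "g (x t)"]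
      by (simp add: field_simps)
  qed
  ultimately show ?thesis by simp
qed

lemma pairing_integral_deriv:
  assumes "t > t0 + 1"
  shows "(pairing_integral has_real_derivative pairing t) (at t)"
proof -
  \<comment> \<open>The window extends to \<open>t + 1\<close> so that \<open>t\<close> is interior
    and the derivative is two-sided.\<close>
  have "continuous_on {t0 + 1..t + 1} x"
    by (intro continuous_at_imp_continuous_on ballI has_vector_derivative_continuous[OF x_deriv]) simp
  then have "continuous_on {t0 + 1..t + 1} pairing"
    unfolding pairing_def by (intro continuous_intros continuous_on_compose2[OF cont_g]) auto
  then have "(pairing_integral has_real_derivative pairing t) (at t within {t0 + 1..t + 1})"
    unfolding pairing_integral_def using assms by (intro integral_has_real_derivative) auto
  moreover have "at t within {t0 + 1..t + 1} = at t"
    using assms by (intro at_within_interior) (simp add: interior_atLeastAtMost_real)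
  ultimately show ?thesis by simp
qed

text \<open>The integral of a non-integrable function is 0 by default, so the bound holds for every
  \<open>t\<close> without an integrability argument.\<close>

lemma pairing_integral_nonneg: "0 \<le> pairing_integral t"
  unfolding pairing_integral_def
  by (cases "pairing integrable_on {t0 + 1..t}")
    (auto intro!: integral_nonneg order_trans[OF gap_nonneg gap_le_pairing] simp: not_integrable_integral)

section \<open>Decay of the energy and convergence of the distance\<close>

text \<open>Since \<open>gap\<close> is at most \<open>pairing\<close>, the leading terms
  \<open>2 t gap - l t pairing\<close> are at most \<open>-(l - 2) t pairing\<close>, so
  \<open>l > 2\<close> gives decay; \<open>l < alpha - 1\<close> gives the velocity term its
  sign.\<close>

lemma energy_rate_le:
  assumes l: "2 < l" "l < \<alpha> - 1"
  shows "\<exists>T. \<forall>t\<ge>T. energy_rate l t \<le> - ((l - 2) / 2) * pairing t"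
proof -
  define c where "c = \<beta> * (l + 2 - \<alpha>)"
  define C where "C = \<bar>c\<bar> + l * \<beta>"
  \<comment> \<open>\<open>beta\<close> fixes the sign of the gradient term, \<open>1\<close> allows
    replacing \<open>t\<close> by 1 in the decay, and the last bound absorbs the constant
    \<open>C\<close> into half of \<open>(l - 2) t\<close>.\<close>
  define T where "T = max (max \<beta> 1) (2 * C / (l - 2))"
  have "energy_rate l t \<le> - ((l - 2) / 2) * pairing t" if "t \<ge> T" for t
  proof -
    have t: "t \<ge> \<beta>" "t \<ge> 1" "t \<ge> 2 * C / (l - 2)" using that by (auto simp: T_def)
    have w: "0 \<le> pairing t" using gap_nonneg gap_le_pairing order_trans by blast
    have "(2 * t - c) * gap t \<le> (2 * t + \<bar>c\<bar>) * gap t"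
      using gap_nonneg by (intro mult_right_mono) auto
    also have "\<dots> \<le> (2 * t + \<bar>c\<bar>) * pairing t"
      using gap_le_pairing t by (intro mult_left_mono) auto
    finally have "(2 * t - c) * gap t - l * (t - \<beta>) * pairing t \<le> (C - (l - 2) * t) * pairing t"
      by (simp add: C_def algebra_simps)
    also have "\<dots> \<le> - ((l - 2) / 2) * pairing t"
    proof (rule mult_right_mono[OF _ w])
      have "C \<le> (l - 2) * t / 2" using t(3) l by (simp add: field_simps)
      moreover have "(l - 2) * 1 \<le> (l - 2) * t" using t(2) l by (intro mult_left_mono) auto
      ultimately show "C - (l - 2) * t \<le> - ((l - 2) / 2)" by linarith
    qed
    moreover have "0 \<le> t * (\<alpha> - 1 - l) * (norm (v t))\<^sup>2" using t l by simp
    moreover have "0 \<le> t * \<beta> * (t - \<beta>) * (norm (g (x t)))\<^sup>2" using t \<beta> by simp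
    ultimately show ?thesis unfolding energy_rate_def c_def by linarith
  qed
  then show ?thesis by blast
qed

text \<open>For such \<open>t\<close> the factor \<open>t - beta (l + 2 - alpha)\<close> is at least
  \<open>t / 2\<close>. The bound yields nonnegativity of the energy and, once the energy converges,
  a gap of order \<open>1 / t^2\<close>.\<close>

lemma energy_ge:
  assumes l: "2 < l" "l < \<alpha> - 1" and t: "t > 0" "t \<ge> 2 * (\<beta> * (l + 2 - \<alpha>))"
  shows "t\<^sup>2 / 2 * gap t \<le> energy l t"
proof -
  have "t\<^sup>2 / 2 * gap t \<le> t * (t - \<beta> * (l + 2 - \<alpha>)) * gap t"
  proof (rule mult_right_mono[OF _ gap_nonneg])
    have "t * (t / 2) \<le> t * (t - \<beta> * (l + 2 - \<alpha>))" using t by (intro mult_left_mono) auto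
    then show "t\<^sup>2 / 2 \<le> t * (t - \<beta> * (l + 2 - \<alpha>))" by (simp add: power2_eq_square)
  qed
  moreover have "0 \<le> l * (\<alpha> - l - 1) / 2 * (norm (x t - z))\<^sup>2" using l by simp
  ultimately show ?thesis unfolding energy_def by (simp add: add_increasing2)
qed

lemma energy_limits:
  assumes l: "2 < l" "l < \<alpha> - 1"
  shows energy_convergent: "\<exists>L. (energy l \<longlongrightarrow> L) at_top"
    and pairing_integral_convergent: "\<exists>L. (pairing_integral \<longlongrightarrow> L) at_top"
    and time_gap_tendsto: "((\<lambda>t. t * gap t) \<longlongrightarrow> 0) at_top"
proof -
  define c where "c = 2 * (\<beta> * (l + 2 - \<alpha>))"
  obtain T0 where T0: "\<And>t. t \<ge> T0 \<Longrightarrow> energy_rate l t \<le> - ((l - 2) / 2) * pairing t"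
    using energy_rate_le[OF l] by blast
  define T where "T = max T0 (max (t0 + 2) c)"
  have T: "t \<ge> T0" "t > t0 + 1" "t > t0" "t > 0" "t \<ge> c" if "t \<ge> T" for t
    using that t0 by (auto simp: T_def)
  have w: "0 \<le> pairing t" for t using gap_nonneg gap_le_pairing order_trans by blast
  have E0: "0 \<le> energy l t" if "t \<ge> T" for t
    using energy_ge[OF l, of t] T[OF that] gap_nonneg[of t]
    by (smt (verit) c_def mult_nonneg_nonneg zero_le_power2 divide_nonneg_pos)
  show E: "\<exists>L. (energy l \<longlongrightarrow> L) at_top"
  proof (rule antimono_at_top_convergent)
    fix t assume "t \<ge> T"
    show "(energy l has_real_derivative energy_rate l t) (at t)"
      using energy_deriv T(3)[OF \<open>t \<ge> T\<close>] .
    have "0 \<le> (l - 2) / 2 * pairing t" using w l by simp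
    then show "energy_rate l t \<le> 0" using T0[OF T(1)[OF \<open>t \<ge> T\<close>]] by linarith
  qed (rule E0)
  \<comment> \<open>The decay rate leaves room for this extra term: the sum is still nonincreasing
    and bounded below. Subtracting the convergent energy isolates the integral.\<close>
  have "\<exists>L. ((\<lambda>t. energy l t + (l - 2) / 2 * pairing_integral t) \<longlongrightarrow> L) at_top"
  proof (rule antimono_at_top_convergent)
    fix t assume "t \<ge> T"
    show "((\<lambda>t. energy l t + (l - 2) / 2 * pairing_integral t) has_real_derivative
        energy_rate l t + (l - 2) / 2 * pairing t) (at t)"
      by (intro DERIV_add DERIV_cmult energy_deriv pairing_integral_deriv T[OF \<open>t \<ge> T\<close>])
    show "energy_rate l t + (l - 2) / 2 * pairing t \<le> 0" using T0[OF T(1)[OF \<open>t \<ge> T\<close>]] by linarith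
    show "0 \<le> energy l t + (l - 2) / 2 * pairing_integral t"
      using E0[OF \<open>t \<ge> T\<close>] pairing_integral_nonneg l by simp
  qed
  then obtain L1 L2 where L: "(energy l \<longlongrightarrow> L1) at_top"
    "((\<lambda>t. energy l t + (l - 2) / 2 * pairing_integral t) \<longlongrightarrow> L2) at_top"
    using E by blast
  have "((\<lambda>t. ((energy l t + (l - 2) / 2 * pairing_integral t) - energy l t) / ((l - 2) / 2))
      \<longlongrightarrow> (L2 - L1) / ((l - 2) / 2)) at_top"
    using l by (intro tendsto_divide tendsto_diff L tendsto_const) simp
  then show "\<exists>L. (pairing_integral \<longlongrightarrow> L) at_top" using l by auto
  show "((\<lambda>t. t * gap t) \<longlongrightarrow> 0) at_top"
  proof (rule tendsto_sandwich)
    show "\<forall>\<^sub>F t in at_top. 0 \<le> t * gap t"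
      using eventually_ge_at_top[of 0] by eventually_elim (simp add: gap_nonneg)
    show "\<forall>\<^sub>F t in at_top. t * gap t \<le> 2 * energy l t * inverse t"
      using eventually_ge_at_top[of T]
    proof eventually_elim
      case (elim t)
      have "t\<^sup>2 / 2 * gap t \<le> energy l t" using energy_ge[OF l] T[OF elim] by (simp add: c_def)
      then show ?case using T(4)[OF elim] by (simp add: field_simps power2_eq_square)
    qed
    have "((\<lambda>t. 2 * energy l t * inverse t) \<longlongrightarrow> 2 * L1 * 0) at_top"
      by (intro tendsto_intros L tendsto_inverse_0_at_top filterlim_ident)
    then show "((\<lambda>t. 2 * energy l t * inverse t) \<longlongrightarrow> 0) at_top" by simp
  qed simp
qed

lemma gap_tendsto: "(gap \<longlongrightarrow> 0) at_top"
proof -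
  \<comment> \<open>The interval of admissible \<open>l\<close> is nonempty because
    \<open>alpha > 3\<close>.\<close>
  obtain l where l: "2 < l" "l < \<alpha> - 1" using dense[of 2 "\<alpha> - 1"] \<alpha> by auto
  have "((\<lambda>t. (t * gap t) * inverse t) \<longlongrightarrow> 0 * 0) at_top"
    by (intro tendsto_intros time_gap_tendsto[OF l] tendsto_inverse_0_at_top filterlim_ident)
  moreover have "\<forall>\<^sub>F t in at_top. (t * gap t) * inverse t = gap t"
    using eventually_gt_at_top[of 0] by eventually_elim simp
  ultimately show ?thesis using Lim_transform_eventually by force
qed

lemma distance_convergent: "\<exists>L. ((\<lambda>t. (norm (x t - z))\<^sup>2) \<longlongrightarrow> L) at_top"
proof -
  obtain l where l: "2 < l" "l < \<alpha> - 1" using dense[of 2 "\<alpha> - 1"] \<alpha> by auto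
  obtain k where k: "2 < k" "k < l" using dense[of 2 l] l by auto
  then have k': "k < \<alpha> - 1" using l by simp
  obtain L1 L2 W where L: "(energy l \<longlongrightarrow> L1) at_top" "(energy k \<longlongrightarrow> L2) at_top"
    and W: "(pairing_integral \<longlongrightarrow> W) at_top"
    using energy_convergent[OF l] energy_convergent[OF k(1) k'] pairing_integral_convergent[OF l] by blast
  \<comment> \<open>The integral is added so that \<open>t * q'\<close> contains the term
    \<open>t * beta * pairing\<close>, which occurs in the difference of two energies.\<close>
  define q where "q t = (norm (x t - z))\<^sup>2 / 2 + \<beta> * pairing_integral t" for t
  define q' where "q' t = inner (x t - z) (v t) + \<beta> * pairing t" for t
  have "(q \<longlongrightarrow> ((L1 - L2) / (l - k) + \<beta> * 0 + (\<alpha> - 1) * \<beta> * W) / (\<alpha> - 1)) at_top"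
  proof (rule tendsto_at_top_of_weighted)
    show "\<alpha> - 1 > 0" using \<alpha> by simp
    show "\<forall>\<^sub>F t in at_top. (q has_real_derivative q' t) (at t)"
      using eventually_gt_at_top[of "t0 + 1"]
    proof eventually_elim
      case (elim t)
      then have "t > t0" by simp
      have "(q has_real_derivative 2 * inner (x t - z) (v t) / 2 + \<beta> * pairing t) (at t)"
        unfolding q_def
        by (intro DERIV_add DERIV_cmult DERIV_cdivide pairing_integral_deriv[OF elim]
            has_real_derivative_norm_square[OF x_diff_deriv[OF \<open>t > t0\<close>]])
      then show ?case by (simp add: q'_def)
    qed
    have "(\<alpha> - 1) * q t + t * q' t
        = (energy l t - energy k t) / (l - k) + \<beta> * (t * gap t) + (\<alpha> - 1) * \<beta> * pairing_integral t" for t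
    proof -
      \<comment> \<open>For fixed \<open>t\<close> the energy is affine in its parameter
        \<open>m\<close>: the coefficients \<open>m (alpha - m - 1) / 2\<close> and
        \<open>m^2 / 2\<close> of \<open>|x - z|^2\<close> add up to
        \<open>m (alpha - 1) / 2\<close>. Hence the factor \<open>l - k\<close>.\<close>
      have "energy l t - energy k t = (l - k) * ((\<alpha> - 1) / 2 * (norm (x t - z))\<^sup>2
          + t * (inner (x t - z) (v t) + \<beta> * pairing t) - \<beta> * (t * gap t))"
      proof -
        define y where "y = x t - z"
        have "(norm (shift m t))\<^sup>2 = m\<^sup>2 * inner y y
            + 2 * (m * t) * (inner y (v t) + \<beta> * inner y (g (x t)))
            + t\<^sup>2 * inner (v t + \<beta> *\<^sub>R g (x t)) (v t + \<beta> *\<^sub>R g (x t))" for m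
          unfolding shift_def y_def[symmetric] power2_norm_eq_inner
          by (simp add: inner_add_left inner_add_right inner_commute[of "v t" y]
              inner_commute[of "g (x t)" y] power2_eq_square algebra_simps)
        then show ?thesis
          unfolding energy_def pairing_def y_def[symmetric] power2_norm_eq_inner[of y]
          by (simp add: power2_eq_square field_simps)
      qed
      then show ?thesis using k by (simp add: q_def q'_def field_simps)
    qed
    then show "((\<lambda>t. (\<alpha> - 1) * q t + t * q' t) \<longlongrightarrow>
        (L1 - L2) / (l - k) + \<beta> * 0 + (\<alpha> - 1) * \<beta> * W) at_top"
      using k by (simp only:) (intro tendsto_intros L W time_gap_tendsto[OF l], simp)
  qed
  then have "((\<lambda>t. 2 * (q t - \<beta> * pairing_integral t)) \<longlongrightarrow>
      2 * (((L1 - L2) / (l - k) + \<beta> * 0 + (\<alpha> - 1) * \<beta> * W) / (\<alpha> - 1) - \<beta> * W)) at_top"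
    by (intro tendsto_intros W)
  then show ?thesis unfolding q_def by (intro exI) simp
qed

end

subsection \<open>Weak convergence of trajectories\<close>

lemma has_vector_derivative_at_of_atLeast:
  fixes f :: "real \<Rightarrow> 'b::real_normed_vector"
  assumes "(f has_vector_derivative D) (at t within {t0..})" "t0 < t"
  shows "(f has_vector_derivative D) (at t)"
proof -
  have "at t within {t0..} = at t" using assms(2) by (intro at_within_interior) simp
  then show ?thesis using assms(1) by simp
qed

lemma twice_continuously_differentiable_on_atLeastD:
  fixes x :: "real \<Rightarrow> 'a::real_normed_vector"
  assumes x: "twice_continuously_differentiable_on x {t0..}" and "t > t0"
  shows velocity_deriv: "(x has_vector_derivative velocity t0 x t) (at t)"
    and acceleration_deriv: "(velocity t0 x has_vector_derivative acceleration t0 x t) (at t)"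
proof -
  obtain f' :: "real \<Rightarrow> real \<Rightarrow>\<^sub>L 'a" and f''
    where f': "\<And>s. s \<ge> t0 \<Longrightarrow> (x has_derivative blinfun_apply (f' s)) (at s within {t0..})"
    and f'': "\<And>s. s \<ge> t0 \<Longrightarrow> (f' has_derivative blinfun_apply (f'' s)) (at s within {t0..})"
    using x unfolding twice_continuously_differentiable_on_def by auto
  \<comment> \<open>Nontriviality, also at the end point \<open>t0\<close>, makes vector derivatives
    within the half-line unique.\<close>
  have nt: "at s within {t0..} \<noteq> bot" if "s \<ge> t0" for s
    using that at_le[of "{s<..}" "{t0..}" s] trivial_limit_at_right_real[of s] bot.extremum_uniqueI
    by force
  have v: "velocity t0 x s = f' s 1"
    and xv: "(x has_vector_derivative f' s 1) (at s within {t0..})" if "s \<ge> t0" for s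
  proof -
    have "blinfun_apply (f' s) = (\<lambda>h. h *\<^sub>R f' s 1)"
      by (simp add: fun_eq_iff flip: blinfun.scaleR_right)
    with f'[OF that] show *: "(x has_vector_derivative f' s 1) (at s within {t0..})"
      by (simp add: has_vector_derivative_def)
    show "velocity t0 x s = f' s 1"
      unfolding velocity_def by (rule vector_derivative_within[OF nt[OF that] *])
  qed
  show "(x has_vector_derivative velocity t0 x t) (at t)"
    using xv[of t] v[of t] assms(2) has_vector_derivative_at_of_atLeast by fastforce
  have "((\<lambda>s. f' s 1) has_vector_derivative f'' t 1 1) (at t within {t0..})"
  proof -
    have "((\<lambda>s. f' s 1) has_derivative (\<lambda>h. f'' t h 1)) (at t within {t0..})"
      using bounded_linear.has_derivative[OF blinfun.bounded_linear_left f''[of t]] assms(2) by simp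
    moreover have "(\<lambda>h. f'' t h 1) = (\<lambda>h. h *\<^sub>R f'' t 1 1)"
    proof
      show "f'' t h 1 = h *\<^sub>R f'' t 1 1" for h
        using blinfun.scaleR_right[of "f'' t" h 1]
        by (simp only: blinfun.scaleR_left real_scaleR_def mult_1_right)
    qed
    ultimately show ?thesis
      unfolding has_vector_derivative_def by (rule has_derivative_eq_rhs)
  qed
  \<comment> \<open>The velocity equals \<open>f' s 1\<close> on the whole half-line, so the
    derivative transfers within it before becoming two-sided.\<close>
  then have "(velocity t0 x has_vector_derivative f'' t 1 1) (at t within {t0..})"
    using assms(2) by (elim has_vector_derivative_transform[rotated 2]) (auto simp: v)
  then show "(velocity t0 x has_vector_derivative acceleration t0 x t) (at t)"
    using has_vector_derivative_at_of_atLeast[OF _ assms(2)] vector_derivative_within[OF nt] assms(2)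
    by (metis acceleration_def less_imp_le)
qed

theorem theorem1p14:
  fixes \<Phi> :: "'a::{real_inner, banach} \<Rightarrow> real"
    and x :: "real \<Rightarrow> 'a"
    and \<alpha> \<beta> t0 :: real
  assumes "\<alpha> > 3" and "\<beta> > 0" and "t0 > 0"
    and "twice_continuously_differentiable_on \<Phi> UNIV"
    and "convex_on UNIV \<Phi>"
    and "argmin \<Phi> \<noteq> {}"
    and "din_avd_solution \<alpha> \<beta> t0 \<Phi> x"
  shows "\<exists>z \<in> argmin \<Phi>. weakly_tendsto x z at_top"
proof -
  have x: "twice_continuously_differentiable_on x {t0..}"
    and ode: "\<And>t. t \<ge> t0 \<Longrightarrow> acceleration t0 x t + (\<alpha> / t) *\<^sub>R velocity t0 x t
        + \<beta> *\<^sub>R hessian \<Phi> (x t) (velocity t0 x t) + gradient \<Phi> (x t) = 0"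
    using assms(7) by (auto simp: din_avd_solution_def)
  note gd = gradient_has_derivative_hessian[OF assms(4)]
  have u: "((\<lambda>t. velocity t0 x t + \<beta> *\<^sub>R gradient \<Phi> (x t)) has_vector_derivative
      - ((\<alpha> / t) *\<^sub>R velocity t0 x t) - gradient \<Phi> (x t)) (at t)" if "t > t0" for t
  proof -
    have "((\<lambda>t. gradient \<Phi> (x t)) has_vector_derivative hessian \<Phi> (x t) (velocity t0 x t)) (at t)"
      using vector_derivative_diff_chain_within[OF velocity_deriv[OF x that]
          has_derivative_at_withinI[OF gd]]
      by (simp add: o_def)
    from has_vector_derivative_add[OF acceleration_deriv[OF x that]
        bounded_linear.has_vector_derivative[OF bounded_linear_scaleR_right[of \<beta>] this]]
    show ?thesis
      by (rule has_vector_derivative_eq_rhs) (use ode[of t] that in \<open>simp add: algebra_simps eq_neg_iff_add_eq_0\<close>)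
  qed
  \<comment> \<open>The minimiser stays a parameter: Opial's argument needs the distance to converge
    for every point of \<open>argmin\<close>.\<close>
  have din: "din_avd \<Phi> (gradient \<Phi>) x (velocity t0 x) \<alpha> \<beta> t0 z" if "z \<in> argmin \<Phi>" for z
  proof
    show "continuous_on UNIV (gradient \<Phi>)"
      using gd by (meson has_derivative_continuous continuous_at_imp_continuous_on)
    show "\<And>y. \<Phi> z \<le> \<Phi> y" using that by (auto simp: argmin_def is_arg_min_def not_less)
  qed (use assms GDERIV_gradient[OF assms(4)] velocity_deriv[OF x] u in auto)
  obtain z where z: "z \<in> argmin \<Phi>" using assms(6) by blast
  interpret z: din_avd \<Phi> "gradient \<Phi>" x "velocity t0 x" \<alpha> \<beta> t0 z by (rule din[OF z])
  obtain L where L: "((\<lambda>t. (norm (x t - z))\<^sup>2) \<longlongrightarrow> L) at_top" using z.distance_convergent by blast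
  show ?thesis
  proof (rule opial_weakly_tendsto)
    have "\<forall>\<^sub>F t in at_top. (norm (x t - z))\<^sup>2 < L + 1" using order_tendstoD(2)[OF L] by simp
    then show "\<forall>\<^sub>F t in at_top. norm (x t) \<le> norm z + sqrt (L + 1)"
    proof eventually_elim
      case (elim t)
      then have "norm (x t - z) \<le> sqrt (L + 1)" by (simp add: real_le_rsqrt)
      then show ?case using norm_triangle_sub[of "x t" z] by linarith
    qed
    show "\<exists>L. ((\<lambda>t. (norm (x t - y))\<^sup>2) \<longlongrightarrow> L) at_top" if "y \<in> argmin \<Phi>" for y
      using din_avd.distance_convergent[OF din[OF that]] .
    fix G c assume G: "G \<noteq> bot" "G \<le> at_top"
      and c: "\<And>y. ((\<lambda>t. inner (x t) y) \<longlongrightarrow> inner c y) G"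
    let ?g = "gradient \<Phi> c"
    have "(z.gap \<longlongrightarrow> 0) G" using z.gap_tendsto G(2) tendsto_mono by blast
    \<comment> \<open>The tangent of the objective at \<open>c\<close> is affine in
      \<open>x t\<close>, so weak convergence along \<open>G\<close> suffices for its limit. It lies
      below the objective, whose gap vanishes; hence the value at \<open>c\<close> is at most the
      minimum.\<close>
    moreover have "((\<lambda>t. \<Phi> c + (inner (x t) ?g - inner c ?g) - \<Phi> z) \<longlongrightarrow>
        \<Phi> c + (inner c ?g - inner c ?g) - \<Phi> z) G"
      by (intro tendsto_intros c)
    moreover have "\<Phi> c + (inner (x t) ?g - inner c ?g) - \<Phi> z \<le> z.gap t" for t
      using convex_on_gradient_le[OF assms(5) GDERIV_gradient[OF assms(4)], of c "x t"]
      by (simp add: z.gap_def inner_diff inner_commute)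
    ultimately have "\<Phi> c + (inner c ?g - inner c ?g) - \<Phi> z \<le> 0"
      by (intro tendsto_le[OF G(1)]) auto
    then have "\<Phi> c \<le> \<Phi> y" for y using z.minimum[of y] by linarith
    then show "c \<in> argmin \<Phi>" by (auto simp: argmin_def is_arg_min_def not_less)
  qed simp
qed

end
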